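(* Let $A$ be an algebra in a congruence-modular variety with sequence of Day terms $\mathbf m=(m_0,\dots,m_k)$, and let $\mathcal U,\mathcal V,\mathcal W$ be compatible uniformities on $A$. The following are equivalent: (1) $\mathcal X_{\mathbf m}(\mathcal U,\mathcal V)\le\mathcal W$; (2) $\mathcal X_{\mathbf m}(\mathcal V,\mathcal U)\le\mathcal W$; (3) $C(\mathcal U,\mathcal V;\mathcal W)$; (4) $C(\mathcal V,\mathcal U;\mathcal W)$; (5) $\tilde C(\mathcal U,\mathcal V;\mathcal W)$; (6) $\tilde C(\mathcal V,\mathcal U;\mathcal W)$.
   Context: Algebras have finitary operations (the underlying set may be empty). A uniformity on a set $S$ is a filter $\mathcal U$ of binary relations on $S$ such that every $U\in\mathcal U$ is reflexive, $U\in\mathcal U$ implies $U^{-1}\in\mathcal U$, and for each $U\in\mathcal U$ there is $V\in\mathcal U$ with $V\circ V\subseteq U$. A uniformity $\mathcal U$ on an algebra $A$ is compatible if for each basic operation $\omega$ and $U\in\mathcal U$ there is $\bar U\in\mathcal U$ such that $x_i\mathrel{\bar U}y_i$ for all $i$ implies $\omega(\mathbf x)\mathrel U\omega(\mathbf y)$. Filters (of relations, or of other sets) are nonempty families closed upward and under finite intersection, ordered by reverse inclusion: $\mathcal F\le\mathcal G$ iff $\mathcal G\subseteq\mathcal F$. Day terms for a variety: quaternary terms $m_0,\dots,m_k$ satisfying $m_i(x,y,y,x)=x$ for all $i$; $m_0(x,y,z,w)=x$; $m_k(x,y,z,w)=w$; $m_i(x,x,y,y)=m_{i+1}(x,x,y,y)$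 for even $i<k$; $m_i(x,y,y,z)=m_{i+1}(x,y,y,z)$ for odd $i<k$. For binary relations $U,V$ on $A$, $n,n'\ge0$ and an $(n+n')$-ary term $t$, $\mathrm M_{n,n',t}(U,V)$ is the set of $2\times2$ matrices $\begin{pmatrix} t(\mathbf a,\mathbf b) & t(\mathbf a,\mathbf c) \\ t(\mathbf a',\mathbf b) & t(\mathbf a',\mathbf c) \end{pmatrix}$ with $\mathbf a,\mathbf a'\in A^n$, $\mathbf b,\mathbf c\in A^{n'}$, $a_i\mathrel Ua'_i$ for all $i$ and $b_j\mathrel Vc_j$ for all $j$. $\mathcal M_{n,n',t}(\mathcal U,\mathcal V)$ is the filter of sets of $2\times 2$ matrices over $A$ with base $\{\mathrm M_{n,n',t}(U,V):U\in\mathcal U,V\in\mathcal V\}$, and $\mathcal M(\mathcal U,\mathcal V)=\bigcap_{n,n',t}\mathcal M_{n,n',t}(\mathcal U,\mathcal V)$. For a set $M$ of $2\times 2$ matrices over $A$, $\mathrm x_{\mathbf m}(M)$ is the set of pairs $\langle m_i(a,b,d,c),m_i(a,a,c,c)\rangle$ with $i\le k$ and $\begin{pmatrix} a & b \\ c & d \end{pmatrix}\in M$. $\mathcal X_{\mathbf m}(\mathcal U,\mathcal V)$ is the filter of binary relations on $A$ with base $\{\mathrm x_{\mathbf m}(M):M\in\mathcal M(\mathcal U,\mathcal V)\}$. $C(\mathcal U,\mathcal V;\mathcal W)$ means: for all $n,n'\ge 0$, all $(n+n')$-ary terms $t$ and all $W\in\mathcal W$ there are $U\in\mathcal U$, $V\in\mathcal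 V$, $\bar W\in\mathcal W$ such that $\begin{pmatrix} u_{11} & u_{12} \\ u_{21} & u_{22} \end{pmatrix}\in\mathrm M_{n,n',t}(U,V)$ and $u_{11}\mathrel{\bar W}u_{12}$ imply $u_{21}\mathrel Wu_{22}$. $\tilde C(\mathcal U,\mathcal V;\mathcal W)$ means: for all such $n,n',t$ and $W\in\mathcal W$ there are $U\in\mathcal U$, $V\in\mathcal V$ such that $\begin{pmatrix} u_{11} & u_{12} \\ u_{21} & u_{22} \end{pmatrix}\in\mathrm M_{n,n',t}(U,V)$ and $u_{11}=u_{12}$ imply $u_{21}\mathrel Wu_{22}$. *)

theory Defs
  imports Main
begin

section \<open>Algebras, terms, varieties\<close>

text \<open>A signature is a partial map \<open>sg\<close> from symbols to arities; the symbols are its domain, which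
  may be empty.  Operations take argument lists and only matter on lists of the right length over
  the carrier, which may also be empty.\<close>

record ('f, 'a) ualg =
  carrier :: "'a set"
  opn :: "'f \<Rightarrow> 'a list \<Rightarrow> 'a"

definition algebra :: "('f \<rightharpoonup> nat) \<Rightarrow> ('f, 'a) ualg \<Rightarrow> bool" where
  "algebra sg A \<longleftrightarrow>
     (\<forall>f xs. sg f = Some (length xs) \<longrightarrow> set xs \<subseteq> carrier A \<longrightarrow> opn A f xs \<in> carrier A)"

datatype 'f trm = Var nat | App 'f "'f trm list"

text \<open>\<open>terms sg n\<close> is the set of \<open>n\<close>-ary terms, with variables \<open>Var 0, \<dots>, Var (n - 1)\<close>.\<close>

inductive_set "terms" :: "('f \<rightharpoonup> nat) \<Rightarrow> nat \<Rightarrow> 'f trm set" for sg n where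
  Var: "i < n \<Longrightarrow> Var i \<in> terms sg n"
| App: "sg f = Some (length ts) \<Longrightarrow> \<forall>t\<in>set ts. t \<in> terms sg n \<Longrightarrow> App f ts \<in> terms sg n"

primrec eval :: "('f, 'a) ualg \<Rightarrow> (nat \<Rightarrow> 'a) \<Rightarrow> 'f trm \<Rightarrow> 'a" where
  "eval A \<rho> (Var i) = \<rho> i"
| "eval A \<rho> (App f ts) = opn A f (map (eval A \<rho>) ts)"

definition term_op :: "('f, 'a) ualg \<Rightarrow> 'f trm \<Rightarrow> 'a list \<Rightarrow> 'a" where
  "term_op A t xs = eval A (\<lambda>i. xs ! i) t"

definition satisfies :: "('f, 'a) ualg \<Rightarrow> 'f trm \<times> 'f trm \<Rightarrow> bool" where
  "satisfies A e \<longleftrightarrow> (\<forall>\<rho>. range \<rho> \<subseteq> carrier A \<longrightarrow> eval A \<rho> (fst e) = eval A \<rho> (snd e))"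

text \<open>A variety is an equational class.  HOL cannot quantify over types, so \<open>V\<close> consists of
  those members of the class whose carrier lies in \<open>'a\<close>.  A condition required of every member
  of \<open>V\<close> is therefore implied by the same condition on the whole class.\<close>

definition variety :: "('f \<rightharpoonup> nat) \<Rightarrow> ('f, 'a) ualg set \<Rightarrow> bool" where
  "variety sg V \<longleftrightarrow>
     (\<exists>E \<subseteq> (\<Union>n. terms sg n) \<times> (\<Union>n. terms sg n).
        V = {A. algebra sg A \<and> (\<forall>e\<in>E. satisfies A e)})"

definition congruence :: "('f \<rightharpoonup> nat) \<Rightarrow> ('f, 'a) ualg \<Rightarrow> ('a \<times> 'a) set \<Rightarrow> bool" where
  "congruence sg A \<theta> \<longleftrightarrow> equiv (carrier A) \<theta> \<and>
     (\<forall>f xs ys. sg f = Some (length xs) \<longrightarrow> list_all2 (\<lambda>x y. (x, y) \<in> \<theta>) xs ys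
        \<longrightarrow> (opn A f xs, opn A f ys) \<in> \<theta>)"

definition cong_join ::
    "('f \<rightharpoonup> nat) \<Rightarrow> ('f, 'a) ualg \<Rightarrow> ('a \<times> 'a) set \<Rightarrow> ('a \<times> 'a) set \<Rightarrow> ('a \<times> 'a) set" where
  "cong_join sg A \<alpha> \<beta> = \<Inter>{\<theta>. congruence sg A \<theta> \<and> \<alpha> \<union> \<beta> \<subseteq> \<theta>}"

definition congruence_modular :: "('f \<rightharpoonup> nat) \<Rightarrow> ('f, 'a) ualg set \<Rightarrow> bool" where
  "congruence_modular sg V \<longleftrightarrow>
     (\<forall>A\<in>V. \<forall>\<alpha> \<beta> \<gamma>. congruence sg A \<alpha> \<and> congruence sg A \<beta> \<and> congruence sg A \<gamma> \<and> \<alpha> \<subseteq> \<gamma> \<longrightarrow>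
        cong_join sg A \<alpha> \<beta> \<inter> \<gamma> = cong_join sg A \<alpha> (\<beta> \<inter> \<gamma>))"

definition day_terms ::
    "('f \<rightharpoonup> nat) \<Rightarrow> ('f, 'a) ualg set \<Rightarrow> nat \<Rightarrow> (nat \<Rightarrow> 'f trm) \<Rightarrow> bool" where
  "day_terms sg V k m \<longleftrightarrow>
     (\<forall>i\<le>k. m i \<in> terms sg 4) \<and>
     (\<forall>A\<in>V. \<forall>x\<in>carrier A. \<forall>y\<in>carrier A. \<forall>z\<in>carrier A. \<forall>w\<in>carrier A.
        (\<forall>i\<le>k. term_op A (m i) [x, y, y, x] = x) \<and>
        term_op A (m 0) [x, y, z, w] = x \<and>
        term_op A (m k) [x, y, z, w] = w \<and>
        (\<forall>i<k. even i \<longrightarrow> term_op A (m i) [x, x, y, y] = term_op A (m (Suc i)) [x, x, y, y]) \<and>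
        (\<forall>i<k. odd i \<longrightarrow> term_op A (m i) [x, y, y, z] = term_op A (m (Suc i)) [x, y, y, z]))"


section \<open>Filters and uniformities\<close>

text \<open>Filters on a subset \<open>S\<close> of a type are rendered as library filters \<open>F \<le> principal S\<close>: the
  family meant is \<open>{X \<in> members F. X \<subseteq> S}\<close>, and \<open>X \<in> members F\<close> iff \<open>X \<inter> S\<close> belongs to that
  family.  The library order is reverse inclusion, so intersections of filters are suprema.
  The improper filter is allowed.\<close>

definition members :: "'x filter \<Rightarrow> 'x set set" where
  "members F = {X. \<forall>\<^sub>F x in F. x \<in> X}"

definition filter_of_base :: "'x set set \<Rightarrow> 'x filter" where
  "filter_of_base B = (INF X\<in>B. principal X)"

lemma members_filter_of_base:
  assumes "B \<noteq> {}" and "\<And>X Y. X \<in> B \<Longrightarrow> Y \<in> B \<Longrightarrow> \<exists>Z\<in>B. Z \<subseteq> X \<inter> Y"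
  shows "X \<in> members (filter_of_base B) \<longleftrightarrow> (\<exists>Y\<in>B. Y \<subseteq> X)"
  unfolding members_def filter_of_base_def
  using assms
  by (subst eventually_INF_base) (auto simp: eventually_principal subset_eq)

definition uniformity_on :: "'a set \<Rightarrow> ('a \<times> 'a) filter \<Rightarrow> bool" where
  "uniformity_on S \<U> \<longleftrightarrow> \<U> \<le> principal (S \<times> S) \<and>
     (\<forall>U\<in>members \<U>. Id_on S \<subseteq> U \<and> U\<inverse> \<in> members \<U> \<and> (\<exists>V\<in>members \<U>. V O V \<subseteq> U))"

definition compatible :: "('f \<rightharpoonup> nat) \<Rightarrow> ('f, 'a) ualg \<Rightarrow> ('a \<times> 'a) filter \<Rightarrow> bool" where
  "compatible sg A \<U> \<longleftrightarrow>
     (\<forall>f. \<forall>U\<in>members \<U>. f \<in> dom sg \<longrightarrow> (\<exists>U'\<in>members \<U>. \<forall>xs ys.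
        sg f = Some (length xs) \<longrightarrow> set xs \<subseteq> carrier A \<longrightarrow> set ys \<subseteq> carrier A \<longrightarrow>
        list_all2 (\<lambda>x y. (x, y) \<in> U') xs ys \<longrightarrow> (opn A f xs, opn A f ys) \<in> U))"

definition compatible_uniformity ::
    "('f \<rightharpoonup> nat) \<Rightarrow> ('f, 'a) ualg \<Rightarrow> ('a \<times> 'a) filter \<Rightarrow> bool" where
  "compatible_uniformity sg A \<U> \<longleftrightarrow> uniformity_on (carrier A) \<U> \<and> compatible sg A \<U>"


section \<open>Matrices and centrality\<close>

text \<open>A \<open>2\<times>2\<close> matrix is the pair of its rows.\<close>

type_synonym 'a mat2 = "('a \<times> 'a) \<times> ('a \<times> 'a)"

definition M_set :: "('f, 'a) ualg \<Rightarrow> nat \<Rightarrow> nat \<Rightarrow> 'f trm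
    \<Rightarrow> ('a \<times> 'a) set \<Rightarrow> ('a \<times> 'a) set \<Rightarrow> 'a mat2 set" where
  "M_set A n n' t U V =
     {((term_op A t (a @ b), term_op A t (a @ c)),
       (term_op A t (a' @ b), term_op A t (a' @ c))) | a a' b c.
        length a = n \<and> length a' = n \<and> length b = n' \<and> length c = n' \<and>
        set a \<subseteq> carrier A \<and> set a' \<subseteq> carrier A \<and> set b \<subseteq> carrier A \<and> set c \<subseteq> carrier A \<and>
        (\<forall>i<n. (a ! i, a' ! i) \<in> U) \<and> (\<forall>j<n'. (b ! j, c ! j) \<in> V)}"

definition M_filter_t :: "('f, 'a) ualg \<Rightarrow> nat \<Rightarrow> nat \<Rightarrow> 'f trm
    \<Rightarrow> ('a \<times> 'a) filter \<Rightarrow> ('a \<times> 'a) filter \<Rightarrow> 'a mat2 filter" where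
  "M_filter_t A n n' t \<U> \<V> =
     filter_of_base {M_set A n n' t U V | U V. U \<in> members \<U> \<and> V \<in> members \<V>}"

definition M_filter :: "('f \<rightharpoonup> nat) \<Rightarrow> ('f, 'a) ualg
    \<Rightarrow> ('a \<times> 'a) filter \<Rightarrow> ('a \<times> 'a) filter \<Rightarrow> 'a mat2 filter" where
  "M_filter sg A \<U> \<V> = (SUP n. SUP n'. SUP t\<in>terms sg (n + n'). M_filter_t A n n' t \<U> \<V>)"

lemma members_M_filter:
  "members (M_filter sg A \<U> \<V>) =
     (\<Inter>n n'. \<Inter>t\<in>terms sg (n + n'). members (M_filter_t A n n' t \<U> \<V>))"
  by (auto simp: M_filter_def members_def eventually_Sup)

definition x_set :: "('f, 'a) ualg \<Rightarrow> nat \<Rightarrow> (nat \<Rightarrow> 'f trm) \<Rightarrow> 'a mat2 set \<Rightarrow> ('a \<times> 'a) set" where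
  "x_set A k m M =
     {(term_op A (m i) [a, b, d, c], term_op A (m i) [a, a, c, c]) | i a b c d.
        i \<le> k \<and> ((a, b), (c, d)) \<in> M}"

text \<open>Members of \<open>M_filter\<close> that contain matrices with entries outside the carrier do no harm
  here, since \<open>x_set A k m\<close> is monotone.\<close>

definition X_filter :: "('f \<rightharpoonup> nat) \<Rightarrow> ('f, 'a) ualg \<Rightarrow> nat \<Rightarrow> (nat \<Rightarrow> 'f trm)
    \<Rightarrow> ('a \<times> 'a) filter \<Rightarrow> ('a \<times> 'a) filter \<Rightarrow> ('a \<times> 'a) filter" where
  "X_filter sg A k m \<U> \<V> = filter_of_base (x_set A k m ` members (M_filter sg A \<U> \<V>))"

definition C :: "('f \<rightharpoonup> nat) \<Rightarrow> ('f, 'a) ualg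
    \<Rightarrow> ('a \<times> 'a) filter \<Rightarrow> ('a \<times> 'a) filter \<Rightarrow> ('a \<times> 'a) filter \<Rightarrow> bool" where
  "C sg A \<U> \<V> \<W> \<longleftrightarrow>
     (\<forall>n n'. \<forall>t\<in>terms sg (n + n'). \<forall>W\<in>members \<W>.
        \<exists>U\<in>members \<U>. \<exists>V\<in>members \<V>. \<exists>W'\<in>members \<W>.
        \<forall>u11 u12 u21 u22. ((u11, u12), (u21, u22)) \<in> M_set A n n' t U V \<longrightarrow>
          (u11, u12) \<in> W' \<longrightarrow> (u21, u22) \<in> W)"

definition C_tilde :: "('f \<rightharpoonup> nat) \<Rightarrow> ('f, 'a) ualg
    \<Rightarrow> ('a \<times> 'a) filter \<Rightarrow> ('a \<times> 'a) filter \<Rightarrow> ('a \<times> 'a) filter \<Rightarrow> bool" where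
  "C_tilde sg A \<U> \<V> \<W> \<longleftrightarrow>
     (\<forall>n n'. \<forall>t\<in>terms sg (n + n'). \<forall>W\<in>members \<W>.
        \<exists>U\<in>members \<U>. \<exists>V\<in>members \<V>.
        \<forall>u11 u12 u21 u22. ((u11, u12), (u21, u22)) \<in> M_set A n n' t U V \<longrightarrow>
          u11 = u12 \<longrightarrow> (u21, u22) \<in> W)"

end

theory Submission
  imports Defs
begin

text \<open>Let \<open>X(\<U>,\<V>) \<le> \<W>\<close> and take a matrix with columns \<open>(a, c)\<close> and \<open>(b, d)\<close>. If \<open>b\<close> is close to
  \<open>d\<close>, the Day identities connect \<open>a\<close> to \<open>c\<close> by a chain of at most \<open>5k\<close> small steps through the
  elements \<open>m\<^sub>i(a,a,c,c)\<close>, \<open>m\<^sub>i(a,b,d,c)\<close> and \<open>m\<^sub>i(a,b,b,c)\<close>; after transposition this is \<open>C(\<V>,\<U>;\<W>)\<close>.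
  Conversely, apply \<open>C_tilde(\<U>,\<V>;\<W>)\<close> to the terms
  \<open>m\<^sub>i(t(x\<^sub>1,y\<^sub>1), t(x\<^sub>1,y\<^sub>2), t(x\<^sub>2,y\<^sub>2), t(x\<^sub>2,y\<^sub>1))\<close>: in the row with \<open>x\<^sub>1 = x\<^sub>2\<close> both entries are
  \<open>t(x\<^sub>1,y\<^sub>1)\<close> by \<open>m\<^sub>i(x,y,y,x) = x\<close>, and the other row gives \<open>X(\<U>,\<V>) \<le> \<W>\<close>. Running through these
  implications twice, the second time with \<open>\<U>\<close> and \<open>\<V>\<close> exchanged, closes the circle.\<close>

section \<open>Substitution in terms\<close>

primrec subst :: "(nat \<Rightarrow> 'f trm) \<Rightarrow> 'f trm \<Rightarrow> 'f trm" where
  "subst \<sigma> (Var i) = \<sigma> i"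
| "subst \<sigma> (App f ts) = App f (map (subst \<sigma>) ts)"

lemma eval_subst: "eval A \<rho> (subst \<sigma> t) = eval A (\<lambda>i. eval A \<rho> (\<sigma> i)) t"
  by (induction t) (auto simp: o_def intro!: arg_cong[where f = "opn A _"])

lemma subst_in_terms:
  assumes "t \<in> terms sg n" and "\<And>i. i < n \<Longrightarrow> \<sigma> i \<in> terms sg n'"
  shows "subst \<sigma> t \<in> terms sg n'"
  using assms by (induction rule: terms.induct) (auto intro!: terms.App)

lemma eval_cong:
  assumes "t \<in> terms sg n" and "\<And>i. i < n \<Longrightarrow> \<rho> i = \<rho>' i"
  shows "eval A \<rho> t = eval A \<rho>' t"
  using assms
  by (induction rule: terms.induct) (auto intro!: arg_cong[where f = "opn A _"])

text \<open>Evaluates every composed term built below: \<open>t\<close> contains only variables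
  below \<open>n\<close>, so the values of \<open>\<sigma>\<close> at those indices suffice.\<close>

lemma term_op_subst:
  assumes "t \<in> terms sg n" and "length ys = n" and "\<And>i. i < n \<Longrightarrow> eval A (\<lambda>j. xs ! j) (\<sigma> i) = ys ! i"
  shows "term_op A (subst \<sigma> t) xs = term_op A t ys"
  unfolding term_op_def eval_subst by (rule eval_cong[OF assms(1)]) (use assms in auto)

lemma term_op_closed:
  assumes "algebra sg A" and "t \<in> terms sg n" and "length xs = n" and "set xs \<subseteq> carrier A"
  shows "term_op A t xs \<in> carrier A"
  using assms(2)
proof (induction rule: terms.induct)
  case (Var i)
  then show ?case using assms(3,4) by (auto simp: term_op_def)
next
  case (App f ts)
  then have "set (map (eval A ((!) xs)) ts) \<subseteq> carrier A"
    by (auto simp: term_op_def)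
  with App.hyps(1) assms(1) show ?case
    by (auto simp: term_op_def algebra_def)
qed

section \<open>Uniformities\<close>

lemma members_Int: "X \<in> members F \<Longrightarrow> Y \<in> members F \<Longrightarrow> X \<inter> Y \<in> members F"
  by (auto simp: members_def eventually_conj_iff)

lemma members_mono: "X \<in> members F \<Longrightarrow> X \<subseteq> Y \<Longrightarrow> Y \<in> members F"
  by (auto simp: members_def elim!: eventually_mono)

lemma members_UNIV: "UNIV \<in> members F"
  by (simp add: members_def)

lemma members_INT:
  "finite I \<Longrightarrow> (\<And>i. i \<in> I \<Longrightarrow> X i \<in> members F) \<Longrightarrow> (\<Inter>i\<in>I. X i) \<in> members F"
  by (induction I rule: finite_induct) (auto simp: members_UNIV members_Int)

lemma le_filter_iff_members: "F \<le> G \<longleftrightarrow> members G \<subseteq> members F"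
proof
  assume sub: "members G \<subseteq> members F"
  show "F \<le> G"
    unfolding le_filter_def
  proof (intro allI impI)
    fix P assume "eventually P G"
    then have "Collect P \<in> members G" by (simp add: members_def)
    with sub have "Collect P \<in> members F" by blast
    then show "eventually P F" by (simp add: members_def)
  qed
qed (auto simp: le_filter_def members_def)

lemma uniformity_refl:
  "uniformity_on S \<U> \<Longrightarrow> U \<in> members \<U> \<Longrightarrow> x \<in> S \<Longrightarrow> (x, x) \<in> U"
  by (auto simp: uniformity_on_def)

lemma uniformity_converse:
  "uniformity_on S \<U> \<Longrightarrow> U \<in> members \<U> \<Longrightarrow> U\<inverse> \<in> members \<U>"
  by (auto simp: uniformity_on_def)

lemma uniformity_comp:
  assumes "uniformity_on S \<U>" and "U \<in> members \<U>"
  obtains U' where "U' \<in> members \<U>" "U' O U' \<subseteq> U"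
  using assms by (auto simp: uniformity_on_def)

text \<open>Compatibility passes from basic operations to terms by induction; finite arity enters
  because the relations found for the arguments must be intersected.\<close>

lemma compatible_uniformity_term:
  assumes "algebra sg A" and cu: "compatible_uniformity sg A \<U>"
    and "t \<in> terms sg n" and "U \<in> members \<U>"
  shows "\<exists>U'\<in>members \<U>. \<forall>xs ys. length xs = n \<longrightarrow> length ys = n \<longrightarrow>
           set xs \<subseteq> carrier A \<longrightarrow> set ys \<subseteq> carrier A \<longrightarrow>
           (\<forall>i<n. (xs ! i, ys ! i) \<in> U') \<longrightarrow> (term_op A t xs, term_op A t ys) \<in> U"
  using assms(3,4)
proof (induction arbitrary: U rule: terms.induct)
  case (Var i)
  then show ?case by (auto simp: term_op_def)
next
  case (App f ts)
  obtain U1 where U1: "U1 \<in> members \<U>"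
    "\<And>xs ys. sg f = Some (length xs) \<Longrightarrow> set xs \<subseteq> carrier A \<Longrightarrow> set ys \<subseteq> carrier A \<Longrightarrow>
       list_all2 (\<lambda>x y. (x, y) \<in> U1) xs ys \<Longrightarrow> (opn A f xs, opn A f ys) \<in> U"
    using cu App.hyps(1) App.prems unfolding compatible_uniformity_def compatible_def by blast
  have "\<forall>t\<in>set ts. \<exists>U'. U' \<in> members \<U> \<and> (\<forall>xs ys. length xs = n \<longrightarrow> length ys = n \<longrightarrow>
           set xs \<subseteq> carrier A \<longrightarrow> set ys \<subseteq> carrier A \<longrightarrow>
           (\<forall>i<n. (xs ! i, ys ! i) \<in> U') \<longrightarrow> (term_op A t xs, term_op A t ys) \<in> U1)"
    using App.IH U1(1) by blast
  then obtain G where G: "\<And>t. t \<in> set ts \<Longrightarrow> G t \<in> members \<U>"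
    "\<And>t xs ys. t \<in> set ts \<Longrightarrow> length xs = n \<Longrightarrow> length ys = n \<Longrightarrow>
           set xs \<subseteq> carrier A \<Longrightarrow> set ys \<subseteq> carrier A \<Longrightarrow>
           (\<forall>i<n. (xs ! i, ys ! i) \<in> G t) \<Longrightarrow> (term_op A t xs, term_op A t ys) \<in> U1"
    by metis
  have ts: "\<And>t. t \<in> set ts \<Longrightarrow> t \<in> terms sg n" using App.IH by blast
  show ?case
  \<comment> \<open>For a nullary symbol \<open>ts\<close> is empty and this intersection is
    \<open>UNIV\<close>, still a member.\<close>
  proof (intro bexI[of _ "\<Inter>t\<in>set ts. G t"] allI impI)
    show "(\<Inter>t\<in>set ts. G t) \<in> members \<U>" by (intro members_INT) (auto intro: G(1))
    fix xs ys
    assume *: "length xs = n" "length ys = n" "set xs \<subseteq> carrier A" "set ys \<subseteq> carrier A"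
      "\<forall>i<n. (xs ! i, ys ! i) \<in> (\<Inter>t\<in>set ts. G t)"
    have "(opn A f (map (\<lambda>t. term_op A t xs) ts), opn A f (map (\<lambda>t. term_op A t ys) ts)) \<in> U"
    proof (rule U1(2))
      show "list_all2 (\<lambda>x y. (x, y) \<in> U1) (map (\<lambda>t. term_op A t xs) ts) (map (\<lambda>t. term_op A t ys) ts)"
        using G(2)[OF _ *(1-4)] *(5) by (auto simp: list_all2_conv_all_nth)
    qed (use App.hyps(1) term_op_closed[OF assms(1) ts] * in auto)
    then show "(term_op A (App f ts) xs, term_op A (App f ts) ys) \<in> U"
      by (simp add: term_op_def)
  qed
qed

section \<open>Matrices\<close>

lemma M_set_mono: "U \<subseteq> U' \<Longrightarrow> V \<subseteq> V' \<Longrightarrow> M_set A n n' t U V \<subseteq> M_set A n n' t U' V'"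
  unfolding M_set_def by blast

lemma M_setI:
  assumes "length a = n" "length a' = n" "length b = n'" "length c = n'"
    "set a \<subseteq> carrier A" "set a' \<subseteq> carrier A" "set b \<subseteq> carrier A" "set c \<subseteq> carrier A"
    "\<And>i. i < n \<Longrightarrow> (a ! i, a' ! i) \<in> U" "\<And>j. j < n' \<Longrightarrow> (b ! j, c ! j) \<in> V"
  shows "((term_op A t (a @ b), term_op A t (a @ c)),
          (term_op A t (a' @ b), term_op A t (a' @ c))) \<in> M_set A n n' t U V"
  unfolding M_set_def using assms by blast

lemma M_setE:
  assumes "((u11, u12), (u21, u22)) \<in> M_set A n n' t U V"
  obtains a a' b c where
    "length a = n" "length a' = n" "length b = n'" "length c = n'"
    "set a \<subseteq> carrier A" "set a' \<subseteq> carrier A" "set b \<subseteq> carrier A" "set c \<subseteq> carrier A"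
    "\<forall>i<n. (a ! i, a' ! i) \<in> U" "\<forall>j<n'. (b ! j, c ! j) \<in> V"
    "u11 = term_op A t (a @ b)" "u12 = term_op A t (a @ c)"
    "u21 = term_op A t (a' @ b)" "u22 = term_op A t (a' @ c)"
  using assms unfolding M_set_def by blast

text \<open>The generating sets really form a base: \<open>M_set\<close> is monotone in both
  relations, so intersecting the relations gives a lower bound of two base sets.\<close>

lemma members_M_filter_t:
  "M \<in> members (M_filter_t A n n' t \<U> \<V>) \<longleftrightarrow>
     (\<exists>U\<in>members \<U>. \<exists>V\<in>members \<V>. M_set A n n' t U V \<subseteq> M)"
  unfolding M_filter_t_def
proof (subst members_filter_of_base)
  show "{M_set A n n' t U V | U V. U \<in> members \<U> \<and> V \<in> members \<V>} \<noteq> {}"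
    using members_UNIV by blast
next
  fix X Y
  assume "X \<in> {M_set A n n' t U V | U V. U \<in> members \<U> \<and> V \<in> members \<V>}"
    and "Y \<in> {M_set A n n' t U V | U V. U \<in> members \<U> \<and> V \<in> members \<V>}"
  then obtain U V U' V' where XY: "X = M_set A n n' t U V" "Y = M_set A n n' t U' V'"
    and UV: "U \<in> members \<U>" "V \<in> members \<V>" "U' \<in> members \<U>" "V' \<in> members \<V>" by blast
  show "\<exists>Z\<in>{M_set A n n' t U V | U V. U \<in> members \<U> \<and> V \<in> members \<V>}. Z \<subseteq> X \<inter> Y"
  proof (rule bexI)
    show "M_set A n n' t (U \<inter> U') (V \<inter> V') \<subseteq> X \<inter> Y"
      unfolding XY by (simp add: M_set_mono)
    show "M_set A n n' t (U \<inter> U') (V \<inter> V')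
        \<in> {M_set A n n' t U V | U V. U \<in> members \<U> \<and> V \<in> members \<V>}"
      using members_Int[OF UV(1,3)] members_Int[OF UV(2,4)] by blast
  qed
qed blast

lemma members_X_filter:
  "W \<in> members (X_filter sg A k m \<U> \<V>) \<longleftrightarrow> (\<exists>M\<in>members (M_filter sg A \<U> \<V>). x_set A k m M \<subseteq> W)"
  unfolding X_filter_def
proof (subst members_filter_of_base)
  fix X Y
  assume "X \<in> x_set A k m ` members (M_filter sg A \<U> \<V>)"
    and "Y \<in> x_set A k m ` members (M_filter sg A \<U> \<V>)"
  then obtain M N where XY: "X = x_set A k m M" "Y = x_set A k m N"
    and MN: "M \<in> members (M_filter sg A \<U> \<V>)" "N \<in> members (M_filter sg A \<U> \<V>)" by blast
  show "\<exists>Z\<in>x_set A k m ` members (M_filter sg A \<U> \<V>). Z \<subseteq> X \<inter> Y"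
  proof (rule bexI)
    show "x_set A k m (M \<inter> N) \<subseteq> X \<inter> Y"
      unfolding XY x_set_def by blast
    show "x_set A k m (M \<inter> N) \<in> x_set A k m ` members (M_filter sg A \<U> \<V>)"
      using members_Int[OF MN] by blast
  qed
qed (use members_UNIV in auto)

text \<open>Removes the filter of matrices and treats one term at a time. This works because
  \<open>x_set\<close> has an upper adjoint, and membership in an intersection of filters is tested
  in each of them.\<close>

lemma X_filter_le_iff:
  "X_filter sg A k m \<U> \<V> \<le> \<W> \<longleftrightarrow>
     (\<forall>W\<in>members \<W>. \<forall>n n'. \<forall>t\<in>terms sg (n + n'). \<exists>U\<in>members \<U>. \<exists>V\<in>members \<V>.
        x_set A k m (M_set A n n' t U V) \<subseteq> W)"
proof -
  have "W \<in> members (X_filter sg A k m \<U> \<V>) \<longleftrightarrow>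
     (\<forall>n n'. \<forall>t\<in>terms sg (n + n'). \<exists>U\<in>members \<U>. \<exists>V\<in>members \<V>.
        x_set A k m (M_set A n n' t U V) \<subseteq> W)" for W
  proof -
    \<comment> \<open>\<open>P\<close> is the largest set of matrices whose image under
      \<open>x_set\<close> lies in \<open>W\<close>.\<close>
    define P where "P = {((a, b), (c, d)) | a b c d.
      \<forall>i\<le>k. (term_op A (m i) [a, b, d, c], term_op A (m i) [a, a, c, c]) \<in> W}"
    have galois: "x_set A k m M \<subseteq> W \<longleftrightarrow> M \<subseteq> P" for M
      unfolding x_set_def P_def by (auto; blast)
    have "W \<in> members (X_filter sg A k m \<U> \<V>) \<longleftrightarrow> P \<in> members (M_filter sg A \<U> \<V>)"
      unfolding members_X_filter galois using members_mono by blast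
    then show ?thesis
      unfolding members_M_filter by (simp add: members_M_filter_t galois)
  qed
  then show ?thesis
    unfolding le_filter_iff_members by blast
qed

section \<open>Centrality and the Day terms\<close>

lemma day_termsD:
  assumes "day_terms sg V k m" and "A \<in> V"
    and "x \<in> carrier A" "y \<in> carrier A"
  shows "i \<le> k \<Longrightarrow> term_op A (m i) [x, y, y, x] = x"
    and "z \<in> carrier A \<Longrightarrow> w \<in> carrier A \<Longrightarrow> term_op A (m 0) [x, y, z, w] = x"
    and "z \<in> carrier A \<Longrightarrow> w \<in> carrier A \<Longrightarrow> term_op A (m k) [x, y, z, w] = w"
    and "i < k \<Longrightarrow> even i \<Longrightarrow> term_op A (m i) [x, x, y, y] = term_op A (m (Suc i)) [x, x, y, y]"
    and "i < k \<Longrightarrow> odd i \<Longrightarrow> z \<in> carrier A \<Longrightarrow>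
           term_op A (m i) [x, y, y, z] = term_op A (m (Suc i)) [x, y, y, z]"
  using assms unfolding day_terms_def by blast+

text \<open>Uniform continuity of \<open>q\<close> for lists that differ only in the third place;
  reflexivity handles the other three. In the Day chain this replaces \<open>b\<close> by
  \<open>d\<close>.\<close>

lemma quaternary_third_argument:
  assumes alg: "algebra sg A" and cu: "compatible_uniformity sg A \<W>"
    and q: "q \<in> terms sg 4" and T: "T \<in> members \<W>"
  obtains S where "S \<in> members \<W>"
    "\<And>a b c d. a \<in> carrier A \<Longrightarrow> b \<in> carrier A \<Longrightarrow> c \<in> carrier A \<Longrightarrow> d \<in> carrier A \<Longrightarrow>
       (b, d) \<in> S \<Longrightarrow> (term_op A q [a, b, b, c], term_op A q [a, b, d, c]) \<in> T"
proof -
  have u: "uniformity_on (carrier A) \<W>" using cu by (simp add: compatible_uniformity_def)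
  obtain S where S: "S \<in> members \<W>" "\<forall>xs ys. length xs = 4 \<longrightarrow> length ys = 4 \<longrightarrow>
       set xs \<subseteq> carrier A \<longrightarrow> set ys \<subseteq> carrier A \<longrightarrow>
       (\<forall>i<4. (xs ! i, ys ! i) \<in> S) \<longrightarrow> (term_op A q xs, term_op A q ys) \<in> T"
    using compatible_uniformity_term[OF alg cu q T] by blast
  have "(term_op A q [a, b, b, c], term_op A q [a, b, d, c]) \<in> T"
    if "a \<in> carrier A" "b \<in> carrier A" "c \<in> carrier A" "d \<in> carrier A" "(b, d) \<in> S" for a b c d
    using that uniformity_refl[OF u S(1)]
    by (intro S(2)[rule_format]) (auto simp: numeral_eq_Suc less_Suc_eq)
  with S(1) show ?thesis using that by blast
qed

text \<open>The chain is built by induction on \<open>j\<close>. Its use is at \<open>j = k\<close>,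
  where \<open>m k\<close> is the last projection and the conclusion becomes
  \<open>(a, c) \<in> W\<close>.\<close>

lemma day_chain:
  assumes alg: "algebra sg A" and day: "day_terms sg V k m" and AV: "A \<in> V"
    and cu: "compatible_uniformity sg A \<W>"
    and "j \<le> k" and "W \<in> members \<W>"
  shows "\<exists>W'\<in>members \<W>. \<forall>a\<in>carrier A. \<forall>b\<in>carrier A. \<forall>c\<in>carrier A. \<forall>d\<in>carrier A.
           (b, d) \<in> W' \<longrightarrow>
           (\<forall>i\<le>k. (term_op A (m i) [a, b, d, c], term_op A (m i) [a, a, c, c]) \<in> W') \<longrightarrow>
           (a, term_op A (m j) [a, a, c, c]) \<in> W"
  using assms(5,6)
proof (induction j arbitrary: W)
  have u: "uniformity_on (carrier A) \<W>" using cu by (simp add: compatible_uniformity_def)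
  case 0
  then show ?case
    using uniformity_refl[OF u] by (intro bexI[of _ W]) (auto simp: day_termsD(2)[OF day AV])
next
  case (Suc j)
  have u: "uniformity_on (carrier A) \<W>" using cu by (simp add: compatible_uniformity_def)
  show ?case
  proof (cases "even j")
    case True
    \<comment> \<open>For even \<open>j\<close> the end point does not move, as \<open>m j\<close>
      and \<open>m (Suc j)\<close> agree on \<open>[a, a, c, c]\<close>.\<close>
    with Suc show ?thesis using day_termsD(4)[OF day AV] by simp
  next
    case False
    \<comment> \<open>Three halvings leave room for eight small steps. Five are needed, and
      reflexive steps at \<open>x5\<close> fill the rest, which is why \<open>chain\<close> asks for
      \<open>x5\<close> in the carrier.\<close>
    obtain W1 where W1: "W1 \<in> members \<W>" "W1 O W1 \<subseteq> W" using uniformity_comp[OF u Suc.prems(2)] .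
    obtain W2 where W2: "W2 \<in> members \<W>" "W2 O W2 \<subseteq> W1" using uniformity_comp[OF u W1(1)] .
    obtain W3 where W3: "W3 \<in> members \<W>" "W3 O W3 \<subseteq> W2" using uniformity_comp[OF u W2(1)] .
    define T where "T = W3 \<inter> W3\<inverse>"
    have T: "T \<in> members \<W>" unfolding T_def by (intro members_Int uniformity_converse[OF u] W3(1))
    have Tsym: "(x, y) \<in> T \<Longrightarrow> (y, x) \<in> T" for x y by (auto simp: T_def)
    have Trefl: "x \<in> carrier A \<Longrightarrow> (x, x) \<in> T" for x by (rule uniformity_refl[OF u T])
    have chain: "(x0, x5) \<in> W" if "(x0, x1) \<in> T" "(x1, x2) \<in> T" "(x2, x3) \<in> T" "(x3, x4) \<in> T"
      "(x4, x5) \<in> T" "x5 \<in> carrier A" for x0 x1 x2 x3 x4 x5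
    proof -
      have "(x0, x2) \<in> W2" "(x2, x4) \<in> W2" "(x4, x5) \<in> W2" "(x5, x5) \<in> W2"
        using that W3(2) Trefl[of x5] by (auto simp: T_def)
      then have "(x0, x4) \<in> W1" "(x4, x5) \<in> W1" using W2(2) by auto
      then show ?thesis using W1(2) by auto
    qed
    have mj: "m j \<in> terms sg 4" "m (Suc j) \<in> terms sg 4"
      using day Suc.prems(1) by (auto simp: day_terms_def)
    obtain S where S: "S \<in> members \<W>" "\<And>a b c d. a \<in> carrier A \<Longrightarrow> b \<in> carrier A \<Longrightarrow>
        c \<in> carrier A \<Longrightarrow> d \<in> carrier A \<Longrightarrow> (b, d) \<in> S \<Longrightarrow>
        (term_op A (m j) [a, b, b, c], term_op A (m j) [a, b, d, c]) \<in> T"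
      using quaternary_third_argument[OF alg cu mj(1) T] by blast
    obtain S' where S': "S' \<in> members \<W>" "\<And>a b c d. a \<in> carrier A \<Longrightarrow> b \<in> carrier A \<Longrightarrow>
        c \<in> carrier A \<Longrightarrow> d \<in> carrier A \<Longrightarrow> (b, d) \<in> S' \<Longrightarrow>
        (term_op A (m (Suc j)) [a, b, b, c], term_op A (m (Suc j)) [a, b, d, c]) \<in> T"
      using quaternary_third_argument[OF alg cu mj(2) T] by blast
    \<comment> \<open>The induction hypothesis is used for \<open>T\<close> instead of
      \<open>W\<close>, so the whole chain up to \<open>m j\<close> counts as a single small
      step.\<close>
    obtain R where R: "R \<in> members \<W>" "\<And>a b c d. a \<in> carrier A \<Longrightarrow> b \<in> carrier A \<Longrightarrow>
        c \<in> carrier A \<Longrightarrow> d \<in> carrier A \<Longrightarrow> (b, d) \<in> R \<Longrightarrow>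
        (\<forall>i\<le>k. (term_op A (m i) [a, b, d, c], term_op A (m i) [a, a, c, c]) \<in> R) \<Longrightarrow>
        (a, term_op A (m j) [a, a, c, c]) \<in> T"
      using Suc.IH[OF _ T] Suc.prems(1) by (meson Suc_leD)
    show ?thesis
    proof (intro bexI[of _ "R \<inter> S \<inter> S' \<inter> T"] ballI impI)
      show "R \<inter> S \<inter> S' \<inter> T \<in> members \<W>" by (intro members_Int R(1) S(1) S'(1) T)
      fix a b c d
      assume car: "a \<in> carrier A" "b \<in> carrier A" "c \<in> carrier A" "d \<in> carrier A"
        and bd: "(b, d) \<in> R \<inter> S \<inter> S' \<inter> T"
        and x: "\<forall>i\<le>k. (term_op A (m i) [a, b, d, c], term_op A (m i) [a, a, c, c]) \<in> R \<inter> S \<inter> S' \<inter> T"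
      have xj: "(term_op A (m j) [a, b, d, c], term_op A (m j) [a, a, c, c]) \<in> T"
        and xSj: "(term_op A (m (Suc j)) [a, b, d, c], term_op A (m (Suc j)) [a, a, c, c]) \<in> T"
        using x[rule_format, of j] x[rule_format, of "Suc j"] Suc.prems(1) by simp_all
      have "(a, term_op A (m j) [a, a, c, c]) \<in> T"
        by (rule R(2)[OF car]) (use bd x in simp_all)
      moreover note Tsym[OF xj]
      \<comment> \<open>Replacing \<open>d\<close> by \<open>b\<close> leads to \<open>m j\<close>
        at \<open>[a, b, b, c]\<close>, where for odd \<open>j\<close> it agrees with
        \<open>m (Suc j)\<close>.\<close>
      moreover have "(term_op A (m j) [a, b, d, c], term_op A (m (Suc j)) [a, b, b, c]) \<in> T"
        using Tsym[OF S(2)[OF car]] bd day_termsD(5)[OF day AV car(1,2) _ False car(3)] Suc.prems(1)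
        by simp
      moreover have "(term_op A (m (Suc j)) [a, b, b, c], term_op A (m (Suc j)) [a, b, d, c]) \<in> T"
        using S'(2)[OF car] bd by blast
      moreover note xSj
      moreover have "term_op A (m (Suc j)) [a, a, c, c] \<in> carrier A"
        using car by (intro term_op_closed[OF alg mj(2)]) auto
      ultimately show "(a, term_op A (m (Suc j)) [a, a, c, c]) \<in> W" by (rule chain)
    qed
  qed
qed

text \<open>The chain turns closeness of the right column into closeness of the left one, whereas
  \<open>C\<close> speaks of rows. Transposing the matrix is what exchanges \<open>\<U>\<close> and
  \<open>\<V>\<close>.\<close>

lemma C_of_X_filter_le:
  assumes alg: "algebra sg A" and day: "day_terms sg V k m" and AV: "A \<in> V"
    and uV: "uniformity_on (carrier A) \<V>" and cu: "compatible_uniformity sg A \<W>"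
    and X: "X_filter sg A k m \<U> \<V> \<le> \<W>"
  shows "C sg A \<V> \<U> \<W>"
  unfolding C_def
proof (intro allI ballI)
  fix n n' t W
  assume t: "t \<in> terms sg (n + n')" and W: "W \<in> members \<W>"
  obtain W' where W': "W' \<in> members \<W>"
    "\<And>a b c d. a \<in> carrier A \<Longrightarrow> b \<in> carrier A \<Longrightarrow> c \<in> carrier A \<Longrightarrow> d \<in> carrier A \<Longrightarrow>
       (b, d) \<in> W' \<Longrightarrow>
       (\<forall>i\<le>k. (term_op A (m i) [a, b, d, c], term_op A (m i) [a, a, c, c]) \<in> W') \<Longrightarrow>
       (a, term_op A (m k) [a, a, c, c]) \<in> W"
    using day_chain[OF alg day AV cu order_refl W] by blast
  \<comment> \<open>\<open>s\<close> is \<open>t\<close> with its two blocks of variables exchanged;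
    this transposes matrices.\<close>
  define s where "s = subst (\<lambda>i. Var (if i < n then n' + i else i - n)) t"
  have s: "s \<in> terms sg (n' + n)"
    unfolding s_def by (rule subst_in_terms[OF t]) (auto intro!: terms.Var)
  have s_op: "term_op A s (p @ q) = term_op A t (q @ p)" if "length p = n'" "length q = n" for p q
    unfolding s_def by (rule term_op_subst[OF t]) (use that in \<open>auto simp: nth_append\<close>)
  obtain U V where UV: "U \<in> members \<U>" "V \<in> members \<V>"
    "x_set A k m (M_set A n' n s U V) \<subseteq> W'"
    using X W'(1) s unfolding X_filter_le_iff by blast
  show "\<exists>V\<in>members \<V>. \<exists>U\<in>members \<U>. \<exists>W'\<in>members \<W>.
        \<forall>u11 u12 u21 u22. ((u11, u12), (u21, u22)) \<in> M_set A n n' t V U \<longrightarrow>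
          (u11, u12) \<in> W' \<longrightarrow> (u21, u22) \<in> W"
  \<comment> \<open>The converse of \<open>V\<close> is needed because the columns of the transposed
    matrix are also swapped: \<open>a'\<close> must come before \<open>a\<close>, so that the row
    assumed close ends up as the right column.\<close>
  proof (rule bexI[of _ "V\<inverse>"], rule bexI[of _ U], rule bexI[of _ W'], intro allI impI)
    fix u11 u12 u21 u22
    assume M: "((u11, u12), (u21, u22)) \<in> M_set A n n' t (V\<inverse>) U" and bd: "(u11, u12) \<in> W'"
    from M obtain a a' b c where *:
      "length a = n" "length a' = n" "length b = n'" "length c = n'"
      "set a \<subseteq> carrier A" "set a' \<subseteq> carrier A" "set b \<subseteq> carrier A" "set c \<subseteq> carrier A"
      "\<forall>i<n. (a ! i, a' ! i) \<in> V\<inverse>" "\<forall>j<n'. (b ! j, c ! j) \<in> U"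
      and u: "u11 = term_op A t (a @ b)" "u12 = term_op A t (a @ c)"
      "u21 = term_op A t (a' @ b)" "u22 = term_op A t (a' @ c)"
      by (rule M_setE)
    have "((term_op A s (b @ a'), term_op A s (b @ a)), (term_op A s (c @ a'), term_op A s (c @ a)))
        \<in> M_set A n' n s U V"
      using * by (intro M_setI) auto
    then have "((u21, u11), (u22, u12)) \<in> M_set A n' n s U V"
      using * by (simp add: s_op u)
    then have x: "\<forall>i\<le>k. (term_op A (m i) [u21, u11, u12, u22],
        term_op A (m i) [u21, u21, u22, u22]) \<in> W'"
      using UV(3) unfolding x_set_def by blast
    have car: "u21 \<in> carrier A" "u11 \<in> carrier A" "u22 \<in> carrier A" "u12 \<in> carrier A"
      unfolding u using * by (auto intro!: term_op_closed[OF alg t])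
    have "term_op A (m k) [u21, u21, u22, u22] = u22"
      using car by (intro day_termsD(3)[OF day AV])
    then show "(u21, u22) \<in> W"
      using W'(2)[OF car bd x] by simp
  qed (use UV W'(1) uniformity_converse[OF uV] in auto)
qed

text \<open>Equal entries of the upper row lie in the carrier, hence are related by the reflexive
  \<open>W'\<close>.\<close>

lemma C_tilde_of_C:
  assumes alg: "algebra sg A" and u: "uniformity_on (carrier A) \<W>" and C: "C sg A \<U> \<V> \<W>"
  shows "C_tilde sg A \<U> \<V> \<W>"
  unfolding C_tilde_def
proof (intro allI ballI)
  fix n n' t W
  assume t: "t \<in> terms sg (n + n')" and W: "W \<in> members \<W>"
  then obtain U V W' where *: "U \<in> members \<U>" "V \<in> members \<V>" "W' \<in> members \<W>"
    "\<And>u11 u12 u21 u22. ((u11, u12), (u21, u22)) \<in> M_set A n n' t U V \<Longrightarrow>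
          (u11, u12) \<in> W' \<Longrightarrow> (u21, u22) \<in> W"
    using C unfolding C_def by meson
  have "u11 \<in> carrier A" if "((u11, u12), (u21, u22)) \<in> M_set A n n' t U V" for u11 u12 u21 u22
    using that by (elim M_setE) (auto intro!: term_op_closed[OF alg t])
  then show "\<exists>U\<in>members \<U>. \<exists>V\<in>members \<V>.
        \<forall>u11 u12 u21 u22. ((u11, u12), (u21, u22)) \<in> M_set A n n' t U V \<longrightarrow>
          u11 = u12 \<longrightarrow> (u21, u22) \<in> W"
    using * uniformity_refl[OF u *(3)] by metis
qed

text \<open>Each pair in \<open>x_set\<close> is the lower row of a matrix for a composed term whose
  upper row is constant by the identity \<open>m\<^sub>i(x,y,y,x) = x\<close>.\<close>

lemma X_filter_le_of_C_tilde:
  assumes alg: "algebra sg A" and day: "day_terms sg V k m" and AV: "A \<in> V"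
    and uU: "uniformity_on (carrier A) \<U>" and uV: "uniformity_on (carrier A) \<V>"
    and Ct: "C_tilde sg A \<U> \<V> \<W>"
  shows "X_filter sg A k m \<U> \<V> \<le> \<W>"
  unfolding X_filter_le_iff
proof (intro allI ballI)
  fix W n n' t
  assume W: "W \<in> members \<W>" and t: "t \<in> terms sg (n + n')"
  \<comment> \<open>The variables come in four blocks
    \<open>x\<^sub>1, x\<^sub>2, y\<^sub>1, y\<^sub>2\<close> of lengths
    \<open>n, n, n', n'\<close>; \<open>p\<close> and \<open>q\<close>, counted from 0, choose the
    blocks inserted into \<open>t\<close>.\<close>
  define l where "l p q = subst (\<lambda>i. Var (if i < n then p * n + i else n + n + q * n' + (i - n))) t"
    for p q :: nat
  have l: "l p q \<in> terms sg ((n + n) + (n' + n'))" if "p < 2" "q < 2" for p q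
    unfolding l_def using that
    by (intro subst_in_terms[OF t] terms.Var) (auto simp: less_2_cases_iff)
  \<comment> \<open>Stated with \<open>eval\<close>, the form in which \<open>term_op_subst\<close>
    expects the values of the substituted terms.\<close>
  have l_op:
    "eval A ((!) ((a @ a') @ (b @ c))) (l 0 0) = term_op A t (a @ b)"
    "eval A ((!) ((a @ a') @ (b @ c))) (l 0 (Suc 0)) = term_op A t (a @ c)"
    "eval A ((!) ((a @ a') @ (b @ c))) (l (Suc 0) 0) = term_op A t (a' @ b)"
    "eval A ((!) ((a @ a') @ (b @ c))) (l (Suc 0) (Suc 0)) = term_op A t (a' @ c)"
    if "length a = n" "length a' = n" "length b = n'" "length c = n'" for a a' b c
    unfolding l_def term_op_def[of _ "subst _ _", symmetric]
    by (rule term_op_subst[OF t]; use that in \<open>auto simp: nth_append\<close>)+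
  \<comment> \<open>The four corners are listed cyclically, matching the order
    \<open>[a, b, d, c]\<close> in \<open>x_set\<close>.\<close>
  define s where "s i = subst (\<lambda>j. [l 0 0, l 0 1, l 1 1, l 1 0] ! j) (m i)" for i
  have mi: "m i \<in> terms sg 4" if "i \<le> k" for i using day that by (auto simp: day_terms_def)
  have s: "s i \<in> terms sg ((n + n) + (n' + n'))" if "i \<le> k" for i
    unfolding s_def
    by (rule subst_in_terms[OF mi[OF that]]) (auto simp: numeral_eq_Suc less_Suc_eq intro!: l)
  have s_op: "term_op A (s i) ((a @ a') @ (b @ c)) = term_op A (m i)
      [term_op A t (a @ b), term_op A t (a @ c), term_op A t (a' @ c), term_op A t (a' @ b)]"
    if "i \<le> k" "length a = n" "length a' = n" "length b = n'" "length c = n'" for i a a' b c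
    unfolding s_def
    by (rule term_op_subst[OF mi[OF that(1)]])
      (use l_op[OF that(2-)] in \<open>auto simp: numeral_eq_Suc less_Suc_eq\<close>)
  \<comment> \<open>Centrality is applied to each \<open>s i\<close> separately; the finitely many
    relations are intersected afterwards.\<close>
  have "\<forall>i\<in>{..k}. \<exists>U V. U \<in> members \<U> \<and> V \<in> members \<V> \<and>
      (\<forall>u11 u12 u21 u22. ((u11, u12), (u21, u22)) \<in> M_set A (n + n) (n' + n') (s i) U V \<longrightarrow>
          u11 = u12 \<longrightarrow> (u21, u22) \<in> W)"
    using Ct s W unfolding C_tilde_def by (metis atMost_iff)
  then obtain F G where FG: "\<And>i. i \<le> k \<Longrightarrow> F i \<in> members \<U>" "\<And>i. i \<le> k \<Longrightarrow> G i \<in> members \<V>"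
    and W: "\<And>i u11 u12 u21 u22. i \<le> k \<Longrightarrow>
      ((u11, u12), (u21, u22)) \<in> M_set A (n + n) (n' + n') (s i) (F i) (G i) \<Longrightarrow>
          u11 = u12 \<Longrightarrow> (u21, u22) \<in> W"
    by (metis atMost_iff)
  show "\<exists>U\<in>members \<U>. \<exists>V\<in>members \<V>. x_set A k m (M_set A n n' t U V) \<subseteq> W"
  proof (intro bexI subsetI)
    show "(\<Inter>i\<in>{..k}. F i) \<in> members \<U>" by (intro members_INT) (auto intro: FG)
    \<comment> \<open>Converses appear because the columns of the matrix for \<open>s i\<close> lead
      from \<open>c\<close> back to \<open>b\<close> in the second \<open>y\<close>-block, which
      puts the pair in the order prescribed by \<open>x_set\<close>.\<close>
    show "(\<Inter>i\<in>{..k}. (G i)\<inverse>) \<in> members \<V>"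
      by (intro members_INT) (auto intro!: FG uniformity_converse[OF uV])
    fix z assume "z \<in> x_set A k m (M_set A n n' t (\<Inter>i\<in>{..k}. F i) (\<Inter>i\<in>{..k}. (G i)\<inverse>))"
    then obtain i u11 u12 u21 u22 where i: "i \<le> k"
      and z: "z = (term_op A (m i) [u11, u12, u22, u21], term_op A (m i) [u11, u11, u21, u21])"
      and M: "((u11, u12), (u21, u22)) \<in> M_set A n n' t (\<Inter>i\<in>{..k}. F i) (\<Inter>i\<in>{..k}. (G i)\<inverse>)"
      unfolding x_set_def by blast
    from M obtain a a' b c where *:
      "length a = n" "length a' = n" "length b = n'" "length c = n'"
      "set a \<subseteq> carrier A" "set a' \<subseteq> carrier A" "set b \<subseteq> carrier A" "set c \<subseteq> carrier A"
      "\<forall>j<n. (a ! j, a' ! j) \<in> (\<Inter>i\<in>{..k}. F i)"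
      "\<forall>j<n'. (b ! j, c ! j) \<in> (\<Inter>i\<in>{..k}. (G i)\<inverse>)"
      and u: "u11 = term_op A t (a @ b)" "u12 = term_op A t (a @ c)"
      "u21 = term_op A t (a' @ b)" "u22 = term_op A t (a' @ c)"
      by (rule M_setE)
    have refl: "(x, x) \<in> F i" "(x, x) \<in> G i" if "x \<in> carrier A" for x
      using that i by (auto intro: uniformity_refl[OF uU] uniformity_refl[OF uV] FG)
    have nth: "j < n \<Longrightarrow> a ! j \<in> carrier A" "j < n' \<Longrightarrow> b ! j \<in> carrier A" for j
      using * by (auto simp: subset_eq)
    have car: "u11 \<in> carrier A" "u12 \<in> carrier A"
      unfolding u using * by (auto intro!: term_op_closed[OF alg t])
    show "z \<in> W"
      unfolding z
    proof (rule W[OF i])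
      \<comment> \<open>Only the second \<open>x\<close>-block changes between rows and only the
        second \<open>y\<close>-block between columns. With \<open>a\<close> in both
        \<open>x\<close>-blocks, both upper entries collapse to \<open>u11\<close>.\<close>
      have "((term_op A (s i) ((a @ a) @ (b @ c)), term_op A (s i) ((a @ a) @ (b @ b))),
             (term_op A (s i) ((a @ a') @ (b @ c)), term_op A (s i) ((a @ a') @ (b @ b))))
          \<in> M_set A (n + n) (n' + n') (s i) (F i) (G i)"
        by (intro M_setI) (use * i refl nth in \<open>auto simp: nth_append\<close>)
      then show "((u11, u11), (term_op A (m i) [u11, u12, u22, u21],
          term_op A (m i) [u11, u11, u21, u21])) \<in> M_set A (n + n) (n' + n') (s i) (F i) (G i)"
        using * i car day_termsD(1)[OF day AV _ _ i]
        \<comment> \<open>Reassociating the appends would destroy the bracketing that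
          \<open>s_op\<close> matches.\<close>
        by (simp add: s_op u del: append_assoc)
    qed simp
  qed
qed

theorem theorem5p3:
  fixes sg :: "'f \<rightharpoonup> nat"
    and V :: "('f, 'a) ualg set"
    and A :: "('f, 'a) ualg"
    and k :: nat
    and m :: "nat \<Rightarrow> 'f trm"
    and \<U> \<V> \<W> :: "('a \<times> 'a) filter"
  assumes "variety sg V"
    and "congruence_modular sg V"
    and "day_terms sg V k m"
    and "A \<in> V"
    and "compatible_uniformity sg A \<U>"
    and "compatible_uniformity sg A \<V>"
    and "compatible_uniformity sg A \<W>"
  shows "(X_filter sg A k m \<U> \<V> \<le> \<W> \<longleftrightarrow> X_filter sg A k m \<V> \<U> \<le> \<W>) \<and>
         (X_filter sg A k m \<U> \<V> \<le> \<W> \<longleftrightarrow> C sg A \<U> \<V> \<W>) \<and>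
         (X_filter sg A k m \<U> \<V> \<le> \<W> \<longleftrightarrow> C sg A \<V> \<U> \<W>) \<and>
         (X_filter sg A k m \<U> \<V> \<le> \<W> \<longleftrightarrow> C_tilde sg A \<U> \<V> \<W>) \<and>
         (X_filter sg A k m \<U> \<V> \<le> \<W> \<longleftrightarrow> C_tilde sg A \<V> \<U> \<W>)"
proof -
  have alg: "algebra sg A"
    using assms(1,4) unfolding variety_def by blast
  note uni = assms(5-7)[unfolded compatible_uniformity_def, THEN conjunct1]
  \<comment> \<open>The six implications form one cycle through all six conditions; its second half
    is the first with \<open>\<U>\<close> and \<open>\<V>\<close> exchanged.\<close>
  have "X_filter sg A k m \<U> \<V> \<le> \<W> \<Longrightarrow> C sg A \<V> \<U> \<W>"
    by (rule C_of_X_filter_le[OF alg assms(3,4) uni(2) assms(7)])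
  moreover have "C sg A \<V> \<U> \<W> \<Longrightarrow> C_tilde sg A \<V> \<U> \<W>"
    by (rule C_tilde_of_C[OF alg uni(3)])
  moreover have "C_tilde sg A \<V> \<U> \<W> \<Longrightarrow> X_filter sg A k m \<V> \<U> \<le> \<W>"
    by (rule X_filter_le_of_C_tilde[OF alg assms(3,4) uni(2,1)])
  moreover have "X_filter sg A k m \<V> \<U> \<le> \<W> \<Longrightarrow> C sg A \<U> \<V> \<W>"
    by (rule C_of_X_filter_le[OF alg assms(3,4) uni(1) assms(7)])
  moreover have "C sg A \<U> \<V> \<W> \<Longrightarrow> C_tilde sg A \<U> \<V> \<W>"
    by (rule C_tilde_of_C[OF alg uni(3)])
  moreover have "C_tilde sg A \<U> \<V> \<W> \<Longrightarrow> X_filter sg A k m \<U> \<V> \<le> \<W>"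
    by (rule X_filter_le_of_C_tilde[OF alg assms(3,4) uni(1,2)])
  ultimately show ?thesis by argo
qed

end
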